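(* Let $x\in\mathbb{X}$, let $A\subset\mathbb{X}$, and assume that $A$ is a closed set under the policy $\pi\in\Pi$. Let $$v^{\pi}(x)=\limsup_{N\to\infty}\frac1N\,\mathbb{E}_x^{\pi}\Big[\sum_{t=0}^{N-1}\mathbf{1}_A(X_t)\Big].$$ Then $v^{\pi}(x)=P_x^{\pi}(\tau_A<\infty)$.
   Context: Markov control model: $\mathbb{X}$ (states) and $\mathbb{U}$ (actions) are countable sets; for each $x\in\mathbb{X}$, $\mathbb{U}(x)\subset\mathbb{U}$ is the set of feasible actions; $\mathbb{K}=\{(x,u): x\in\mathbb{X},u\in\mathbb{U}(x)\}$; $Q$ is a stochastic kernel on $\mathbb{X}$ given $\mathbb{K}$, i.e. $Q(\cdot|x,u)$ is a probability measure on $\mathbb{X}$ for each $(x,u)\in\mathbb{K}$. Admissible histories up to time $t$ are $H_t=\mathbb{K}^t\times\mathbb{X}$, with elements $h_t=(x_0,u_0,\dots,x_{t-1},u_{t-1},x_t)$. A policy is a sequence $\pi=\{\mu_t\}_{t\ge0}$ of stochastic kernels on $\mathbb{U}$ given $H_t$ with $\mu_t(\mathbb{U}(x_t)|h_t)=1$ for all $h_t\in H_t$; $\Pi$ is the set of all policies. For $\pi\in\Pi$ and a distribution $\nu$ on $\mathbb{X}$, $P_\nu^\pi$ is the unique probability measure on $(\mathbb{X}\times\mathbb{U})^{\mathbb{N}}$ (product sigma-algebra, coordinate process $(X_t,U_t)_{t\ge0}$) such that $P_\nu^\pi(\mathbb{K}^{\mathbb{N}})=1$, $X_0\sim\nu$,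 $P_\nu^\pi(U_t\in V|h_t)=\mu_t(V|h_t)$ and $P_\nu^\pi(X_{t+1}\in B|h_t,U_t=u)=Q(B|x_t,u)$. Write $P_x^\pi$, $\mathbb{E}_x^\pi$ when $\nu=\delta_x$. A set $A\subset\mathbb{X}$ is closed under $\pi\in\Pi$ if for every $t\ge 0$ and every history $h_t$ with $x_s\in A$ for some $s\le t$ one has $P_\nu^\pi(X_{t+1}\notin A|h_t)=\sum_{u_t\in\mathbb{U}(x_t)}Q(A^c|x_t,u_t)\mu_t(u_t|h_t)=0$. The hitting time of $A$ is $\tau_A=\inf\{t\ge0: X_t\in A\}$ (with $\inf\emptyset=\infty$). *)

theory Defs
  imports "HOL-Probability.Probability"
begin

text \<open>
  The countable state and action spaces are types of class \<open>countable\<close>, \<open>U x\<close> is the set of actions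
  that are feasible in state \<open>x\<close>, and \<open>Q x u\<close> is the law of the next state. Probability measures on
  countable discrete spaces are rendered as \<open>pmf\<close>. The values of \<open>Q\<close> outside the feasible pairs and
  those of a policy outside the admissible histories are irrelevant.
\<close>

definition feasible_pairs :: "('x \<Rightarrow> 'u set) \<Rightarrow> ('x \<times> 'u) set" where
  "feasible_pairs U = {(x, u). u \<in> U x}"

text \<open>The history \<open>(x\<^sub>0, u\<^sub>0, \<dots>, x\<^sub>t\<^sub>-\<^sub>1, u\<^sub>t\<^sub>-\<^sub>1, x\<^sub>t)\<close> is the pair
  \<open>([(x\<^sub>0, u\<^sub>0), \<dots>, (x\<^sub>t\<^sub>-\<^sub>1, u\<^sub>t\<^sub>-\<^sub>1)], x\<^sub>t)\<close>.\<close>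

type_synonym ('x, 'u) history = "('x \<times> 'u) list \<times> 'x"

definition histories :: "('x \<Rightarrow> 'u set) \<Rightarrow> nat \<Rightarrow> ('x, 'u) history set" where
  "histories U t = {es. length es = t \<and> set es \<subseteq> feasible_pairs U} \<times> UNIV"

definition history_state :: "('x, 'u) history \<Rightarrow> nat \<Rightarrow> 'x" where
  "history_state h s = (if s < length (fst h) then fst (fst h ! s) else snd h)"

type_synonym ('x, 'u) policy = "nat \<Rightarrow> ('x, 'u) history \<Rightarrow> 'u pmf"

definition policies :: "('x \<Rightarrow> 'u set) \<Rightarrow> ('x, 'u) policy set" where
  "policies U = {\<pi>. \<forall>t. \<forall>h\<in>histories U t. measure_pmf.prob (\<pi> t h) (U (snd h)) = 1}"

definition trajectory_space :: "(nat \<Rightarrow> 'x \<times> 'u) measure" where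
  "trajectory_space = PiM UNIV (\<lambda>_. count_space UNIV)"

definition state :: "nat \<Rightarrow> (nat \<Rightarrow> 'x \<times> 'u) \<Rightarrow> 'x" where
  "state t \<omega> = fst (\<omega> t)"

definition action :: "nat \<Rightarrow> (nat \<Rightarrow> 'x \<times> 'u) \<Rightarrow> 'u" where
  "action t \<omega> = snd (\<omega> t)"

definition history_upto :: "nat \<Rightarrow> (nat \<Rightarrow> 'x \<times> 'u) \<Rightarrow> ('x, 'u) history" where
  "history_upto t \<omega> = (map \<omega> [0..<t], state t \<omega>)"

text \<open>Since histories form a countable set, conditioning on a history is elementary conditioning on an
  event of positive probability.\<close>

definition is_strategic_measure ::
  "('x \<Rightarrow> 'u set) \<Rightarrow> ('x \<Rightarrow> 'u \<Rightarrow> 'x pmf) \<Rightarrow> 'x pmf \<Rightarrow> ('x, 'u) policy \<Rightarrow>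
    (nat \<Rightarrow> 'x \<times> 'u) measure \<Rightarrow> bool" where
  "is_strategic_measure U Q \<nu> \<pi> P \<longleftrightarrow>
    prob_space P \<and> sets P = sets trajectory_space \<and>
    \<P>(\<omega> in P. \<forall>t. \<omega> t \<in> feasible_pairs U) = 1 \<and>
    (\<forall>B. \<P>(\<omega> in P. state 0 \<omega> \<in> B) = measure_pmf.prob \<nu> B) \<and>
    (\<forall>t. \<forall>h\<in>histories U t. \<forall>V.
      \<P>(\<omega> in P. history_upto t \<omega> = h) > 0 \<longrightarrow>
      \<P>(\<omega> in P. action t \<omega> \<in> V \<bar> history_upto t \<omega> = h) = measure_pmf.prob (\<pi> t h) V) \<and>
    (\<forall>t. \<forall>h\<in>histories U t. \<forall>u\<in>U (snd h). \<forall>B.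
      \<P>(\<omega> in P. history_upto t \<omega> = h \<and> action t \<omega> = u) > 0 \<longrightarrow>
      \<P>(\<omega> in P. state (Suc t) \<omega> \<in> B \<bar> history_upto t \<omega> = h \<and> action t \<omega> = u)
        = measure_pmf.prob (Q (snd h) u) B)"

definition strategic_measure ::
  "('x \<Rightarrow> 'u set) \<Rightarrow> ('x \<Rightarrow> 'u \<Rightarrow> 'x pmf) \<Rightarrow> 'x pmf \<Rightarrow> ('x, 'u) policy \<Rightarrow>
    (nat \<Rightarrow> 'x \<times> 'u) measure" where
  "strategic_measure U Q \<nu> \<pi> = (THE P. is_strategic_measure U Q \<nu> \<pi> P)"

definition closed_under ::
  "('x \<Rightarrow> 'u set) \<Rightarrow> ('x \<Rightarrow> 'u \<Rightarrow> 'x pmf) \<Rightarrow> ('x, 'u) policy \<Rightarrow> 'x set \<Rightarrow> bool" where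
  "closed_under U Q \<pi> A \<longleftrightarrow>
    (\<forall>t. \<forall>h\<in>histories U t. (\<exists>s\<le>t. history_state h s \<in> A) \<longrightarrow>
      (\<Sum>\<^sub>\<infinity>u\<in>U (snd h). measure_pmf.prob (Q (snd h) u) (- A) * pmf (\<pi> t h) u) = 0)"

definition hitting_time :: "'x set \<Rightarrow> (nat \<Rightarrow> 'x \<times> 'u) \<Rightarrow> enat" where
  "hitting_time A \<omega> = Inf (enat ` {t. state t \<omega> \<in> A})"

text \<open>The definite description in \<open>strategic_measure\<close> is well-defined for every policy. Existence
  comes from the Ionescu-Tulcea extension of the joint kernels for state and action.\<close>

context
  fixes U :: "'x::countable \<Rightarrow> 'u::countable set"
    and Q :: "'x \<Rightarrow> 'u \<Rightarrow> 'x pmf" and \<nu> :: "'x pmf" and \<pi> :: "('x, 'u) policy"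
begin

private definition next_state :: "('x \<times> 'u) list \<Rightarrow> 'x pmf" where
  "next_state es = (if es = [] then \<nu> else Q (fst (last es)) (snd (last es)))"

private definition step :: "('x \<times> 'u) list \<Rightarrow> ('x \<times> 'u) pmf" where
  "step es = bind_pmf (next_state es) (\<lambda>x. map_pmf (Pair x) (\<pi> (length es) (es, x)))"

private lemma prob_step:
  "measure_pmf.prob (step es) ({x} \<times> V) = pmf (next_state es) x * measure_pmf.prob (\<pi> (length es) (es, x)) V"
proof -
  have "measure_pmf.prob (step es) ({x} \<times> V)
      = (\<integral>y. measure_pmf.prob (map_pmf (Pair y) (\<pi> (length es) (es, y))) ({x} \<times> V) \<partial>next_state es)"
    unfolding step_def measure_pmf_bind
    by (rule measure_pmf.measure_bind[where N="count_space UNIV"]) (auto simp: measurable_def space_subprob_algebra measure_pmf.subprob_space_axioms)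
  also have "\<dots> = (\<integral>y. measure_pmf.prob (\<pi> (length es) (es, x)) V * indicator {x} y \<partial>next_state es)"
    by (intro Bochner_Integration.integral_cong)
       (auto simp: measure_map_pmf vimage_def split: split_indicator)
  also have "\<dots> = pmf (next_state es) x * measure_pmf.prob (\<pi> (length es) (es, x)) V"
    by (simp add: measure_pmf_single)
  finally show ?thesis .
qed

private lemma prob_step_state:
  "measure_pmf.prob (step es) (B \<times> UNIV) = measure_pmf.prob (next_state es) B"
proof -
  have "map_pmf fst (step es) = next_state es"
    by (simp add: step_def map_bind_pmf map_pmf_comp bind_return_pmf')
  then have "measure_pmf.prob (next_state es) B = measure_pmf.prob (step es) (fst -` B)"
    by (metis measure_map_pmf)
  also have "fst -` B = B \<times> UNIV" by auto
  finally show ?thesis by simp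
qed

private lemma space_trajectory: "space trajectory_space = UNIV"
  by (simp add: trajectory_space_def space_PiM)

private lemma measurable_prefix_PiM:
  "{0..<n} \<subseteq> I \<Longrightarrow>
    (\<lambda>\<omega>. map \<omega> [0..<n]) \<in> measurable (PiM I (\<lambda>_. count_space UNIV)) (count_space (UNIV :: ('x \<times> 'u) list set))"
proof (induction n)
  case (Suc n)
  let ?M = "PiM I (\<lambda>_. count_space (UNIV :: ('x \<times> 'u) set))"
  have c: "(\<lambda>\<omega>. \<omega> n) \<in> measurable ?M (count_space UNIV)"
    using Suc.prems by (intro measurable_component_singleton) auto
  have i: "(\<lambda>\<omega>. map \<omega> [0..<n]) \<in> measurable ?M (count_space UNIV)"
    using Suc by (simp add: atLeastLessThanSuc)
  have "(\<lambda>\<omega>. (map \<omega> [0..<n], \<omega> n)) \<in> measurable ?M (count_space (UNIV \<times> UNIV))"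
    using measurable_Pair[OF i c] pair_measure_countable[of "UNIV :: ('x \<times> 'u) list set" "UNIV :: ('x \<times> 'u) set"]
    by (simp only: countableI_type)
  then have "(\<lambda>\<omega>. (\<lambda>(es, e). es @ [e]) (map \<omega> [0..<n], \<omega> n)) \<in> measurable ?M (count_space UNIV)"
    by (rule measurable_compose) simp
  then show ?case by simp
qed simp

private lemma measurable_prefix: "(\<lambda>\<omega>. map \<omega> [0..<n]) \<in> measurable trajectory_space (count_space (UNIV :: ('x \<times> 'u) list set))"
  unfolding trajectory_space_def by (rule measurable_prefix_PiM) simp

private lemma trajectory_eqI:
  fixes P P' :: "(nat \<Rightarrow> 'x \<times> 'u) measure"
  assumes "sets P = sets trajectory_space" "sets P' = sets trajectory_space"
    and "finite_measure P"
    and eq: "\<And>n es. emeasure P {\<omega>. map \<omega> [0..<n] = es} = emeasure P' {\<omega>. map \<omega> [0..<n] = es}"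
  shows "P = P'"
proof (rule measure_eqI_PiM_infinite)
  show "sets P = sets (PiM UNIV (\<lambda>_. count_space UNIV))" "sets P' = sets (PiM UNIV (\<lambda>_. count_space UNIV))"
    using assms by (simp_all add: trajectory_space_def)
  show "finite_measure P" by fact
  fix A :: "nat \<Rightarrow> ('x \<times> 'u) set" and J :: "nat set" assume J: "finite J"
  obtain n where n: "J \<subseteq> {0..<n}"
    using J by (auto simp: finite_nat_iff_bounded atLeast0LessThan)
  note mp = measurable_prefix[of n]
  have sp: "space P = UNIV" "space P' = UNIV"
    using sets_eq_imp_space_eq assms(1,2) space_trajectory by metis+
  have m: "(\<lambda>\<omega>. map \<omega> [0..<n]) \<in> measurable P (count_space UNIV)"
    "(\<lambda>\<omega>. map \<omega> [0..<n]) \<in> measurable P' (count_space UNIV)"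
    using mp by (simp_all only: measurable_cong_sets[OF assms(1) refl] measurable_cong_sets[OF assms(2) refl])
  have d: "distr P (count_space UNIV) (\<lambda>\<omega>. map \<omega> [0..<n]) = distr P' (count_space UNIV) (\<lambda>\<omega>. map \<omega> [0..<n])"
    by (rule measure_eqI_countable[where A=UNIV])
       (simp_all add: emeasure_distr m sp vimage_def eq)
  have e: "prod_emb UNIV (\<lambda>_. count_space UNIV) J (Pi\<^sub>E J A)
      = (\<lambda>\<omega>. map \<omega> [0..<n]) -` {es. \<forall>j\<in>J. es ! j \<in> A j}"
    using n by (auto simp: prod_emb_def PiE_iff space_PiM subset_eq)
  show "emeasure P (prod_emb UNIV (\<lambda>_. count_space UNIV) J (Pi\<^sub>E J A)) = emeasure P' (prod_emb UNIV (\<lambda>_. count_space UNIV) J (Pi\<^sub>E J A))"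
    unfolding e using arg_cong[OF d, of "\<lambda>D. emeasure D {es. \<forall>j\<in>J. es ! j \<in> A j}"]
    by (simp add: emeasure_distr m sp)
qed

interpretation IT: Ionescu_Tulcea "\<lambda>n \<omega>. measure_pmf (step (map \<omega> [0..<n]))" "\<lambda>_. count_space UNIV"
proof
  fix n :: nat
  from measurable_compose[OF measurable_prefix_PiM[OF order_refl, of n], of "\<lambda>es. measure_pmf (step es)"]
  show "(\<lambda>\<omega>. measure_pmf (step (map \<omega> [0..<n]))) \<in> measurable (PiM {0..<n} (\<lambda>_. count_space UNIV)) (subprob_algebra (count_space UNIV))"
    by (simp add: space_subprob_algebra measure_pmf.subprob_space_axioms)
qed

private abbreviation "L \<equiv> IT.PF.lim"

private lemma sets_L: "sets L = sets trajectory_space"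
  by (simp add: trajectory_space_def)

private lemma space_L: "space L = UNIV"
  by (metis sets_L sets_eq_imp_space_eq space_trajectory)

interpretation L: prob_space L
  proof
  have "emeasure L (IT.PF.emb UNIV {} {\<lambda>_. undefined}) = emeasure (IT.CI {}) {\<lambda>_. undefined}"
    by (rule IT.lim) (auto simp: PiM_empty)
  also have "IT.PF.emb UNIV {} {\<lambda>_. undefined} = space L"
    unfolding space_L by (auto simp: prod_emb_def space_PiM restrict_def)
  also have "emeasure (IT.CI {}) {\<lambda>_. undefined} = emeasure (IT.CI {}) (space (IT.CI {}))"
    by (simp add: IT.CI_def space_PiM)
  also have "\<dots> = 1"
    by (rule prob_space.emeasure_space_1[OF IT.PF.prob_space_P]) simp_all
  finally show "emeasure L (space L) = 1" .
qed

private lemma sets_prefix: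
  "{\<omega> \<in> space (PiM {0..<n} (\<lambda>_. count_space (UNIV :: ('x \<times> 'u) set))). map \<omega> [0..<n] \<in> T}
    \<in> sets (PiM {0..<n} (\<lambda>_. count_space UNIV))"
  using measurable_sets[OF measurable_prefix_PiM[OF order_refl, of n], of T]
  by (simp add: vimage_def Int_def conj_commute)

private lemma emeasure_L_prefix:
  "emeasure L {\<omega>. map \<omega> [0..<n] \<in> T} = emeasure (IT.C 0 n (\<lambda>_. undefined)) {\<omega> \<in> space (PiM {0..<n} (\<lambda>_. count_space UNIV)). map \<omega> [0..<n] \<in> T}"
  (is "_ = emeasure _ ?X")
proof -
  have X: "?X \<in> sets (PiM {0..<n} (\<lambda>_. count_space UNIV))"
    using measurable_sets[OF measurable_prefix_PiM[OF order_refl, of n], of T]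
    by (simp add: vimage_def Int_def conj_commute)
  have r: "map (restrict \<omega> {0..<n}) [0..<n] = map \<omega> [0..<n]" for \<omega> :: "nat \<Rightarrow> 'x \<times> 'u"
    by simp
  have e: "IT.PF.emb UNIV {0..<n} ?X = {\<omega>. map \<omega> [0..<n] \<in> T}"
    by (auto simp: prod_emb_def space_PiM r simp del: restrict_apply)
  have e': "IT.PF.emb {0..<n} {0..<n} ?X = ?X"
    by (rule prod_emb_id) (auto simp: space_PiM)
  show ?thesis
    using IT.lim[OF _ X] IT.emeasure_CI[OF order_refl X] unfolding e e' by simp
qed

private lemma emeasure_L_Suc:
  "emeasure L {\<omega>. map \<omega> [0..<n] = es \<and> \<omega> n \<in> S} = emeasure L {\<omega>. map \<omega> [0..<n] = es} * emeasure (step es) S"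
proof -
  let ?M = "\<lambda>n. PiM {0..<n} (\<lambda>_. count_space (UNIV :: ('x \<times> 'u) set))"
  let ?T = "{es @ [a] |a. a \<in> S \<and> length es = n}"
  let ?X = "{\<omega> \<in> space (?M (Suc n)). map \<omega> [0..<Suc n] \<in> ?T}"
  have X: "?X \<in> sets (?M (Suc n))"
    by (rule sets_prefix)
  have s0: "(\<lambda>_. undefined) \<in> space (?M 0)" by (auto simp: space_PiM PiE_def extensional_def)
  have "emeasure L {\<omega>. map \<omega> [0..<n] = es \<and> \<omega> n \<in> S} = emeasure L {\<omega>. map \<omega> [0..<Suc n] \<in> ?T}"
    by (rule arg_cong[where f="emeasure L"], rule Collect_cong) (auto simp del: split_paired_Ex)
  also have "\<dots> = emeasure (IT.C 0 (Suc n) (\<lambda>_. undefined)) ?X"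
    by (rule emeasure_L_prefix)
  also have "\<dots> = emeasure (IT.C 0 n (\<lambda>_. undefined) \<bind> IT.eP n) ?X"
    by (simp only: IT.C.simps add_0)
  also have "\<dots> = (\<integral>\<^sup>+\<omega>. emeasure (IT.eP n \<omega>) ?X \<partial>IT.C 0 n (\<lambda>_. undefined))"
  proof (rule emeasure_bind[OF _ _ X])
    show "space (IT.C 0 n (\<lambda>_. undefined)) \<noteq> {}"
      by (rule prob_space.not_empty[OF IT.prob_space_C[OF s0]])
    show "IT.eP n \<in> measurable (IT.C 0 n (\<lambda>_. undefined)) (subprob_algebra (?M (Suc n)))"
      using IT.measurable_eP[of n] by (simp only: measurable_cong_sets[OF IT.sets_C[OF s0, of n] refl] add_0)
  qed
  also have "\<dots> = (\<integral>\<^sup>+\<omega>. emeasure (step es) S * indicator {\<omega> \<in> space (?M n). map \<omega> [0..<n] \<in> {es}} \<omega> \<partial>IT.C 0 n (\<lambda>_. undefined))"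
  proof (rule nn_integral_cong)
    fix \<omega> assume "\<omega> \<in> space (IT.C 0 n (\<lambda>_. undefined))"
    then have w: "\<omega> \<in> space (?M n)" using IT.space_C[OF s0, of n] by simp
    have "emeasure (IT.eP n \<omega>) ?X = emeasure (step (map \<omega> [0..<n])) ((\<lambda>x. fun_upd \<omega> n x) -` ?X)"
      using IT.emeasure_eP[OF w X] by (simp only: space_count_space Int_UNIV_right)
    also have "(\<lambda>x. fun_upd \<omega> n x) -` ?X = (if map \<omega> [0..<n] = es then S else {})"
    proof (rule set_eqI)
      fix a
      have "map (fun_upd \<omega> n a) [0..<Suc n] = map \<omega> [0..<n] @ [a]" by simp
      moreover have "fun_upd \<omega> n a \<in> space (?M (Suc n))"
        using w by (auto simp: space_PiM PiE_iff extensional_def)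
      ultimately show "a \<in> (\<lambda>x. fun_upd \<omega> n x) -` ?X \<longleftrightarrow> a \<in> (if map \<omega> [0..<n] = es then S else {})"
        by (cases "map \<omega> [0..<n] = es") (auto simp del: upt_Suc split_paired_Ex)
    qed
    finally show "emeasure (IT.eP n \<omega>) ?X = emeasure (step es) S * indicator {\<omega> \<in> space (?M n). map \<omega> [0..<n] \<in> {es}} \<omega>"
      using w by simp
  qed
  also have "\<dots> = emeasure (step es) S * emeasure (IT.C 0 n (\<lambda>_. undefined)) {\<omega> \<in> space (?M n). map \<omega> [0..<n] \<in> {es}}"
    by (intro nn_integral_cmult_indicator) (simp only: IT.sets_C[OF s0, of n] add_0 sets_prefix)
  also have "\<dots> = emeasure (step es) S * emeasure L {\<omega>. map \<omega> [0..<n] \<in> {es}}"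
    by (simp only: emeasure_L_prefix)
  finally show ?thesis by (simp add: mult.commute)
qed

private lemma L_Suc:
  "measure L {\<omega>. map \<omega> [0..<n] = es \<and> \<omega> n \<in> S} = measure L {\<omega>. map \<omega> [0..<n] = es} * measure_pmf.prob (step es) S"
  using emeasure_L_Suc[of n es S] by (simp add: measure_def enn2real_mult)

private lemma prefix_Suc: "{\<omega> :: nat \<Rightarrow> 'x \<times> 'u. map \<omega> [0..<Suc n] = es @ [a]} = {\<omega>. map \<omega> [0..<n] = es \<and> \<omega> n \<in> {a}}"
  by auto

private lemma sets_prefix_L: "{\<omega>. map \<omega> [0..<n] \<in> T} \<in> sets L"
  using measurable_sets[OF measurable_prefix[of n], of T] unfolding sets_L by (simp add: vimage_def space_trajectory)

private lemma measurable_coord_L: "(\<lambda>\<omega>. \<omega> n) \<in> measurable L (count_space UNIV)"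
proof -
  have "(\<lambda>\<omega>. \<omega> n) \<in> measurable trajectory_space (count_space (UNIV :: ('x \<times> 'u) set))"
    unfolding trajectory_space_def by (intro measurable_component_singleton) simp
  then show ?thesis by (simp only: measurable_cong_sets[OF sets_L refl])
qed

private lemma sets_prefix_coord_L: "{\<omega>. map \<omega> [0..<n] = es \<and> \<omega> n \<in> S} \<in> sets L"
proof -
  have "{\<omega>. map \<omega> [0..<n] = es \<and> \<omega> n \<in> S} = {\<omega>. map \<omega> [0..<n] \<in> {es}} \<inter> ((\<lambda>\<omega>. \<omega> n) -` S \<inter> space L)"
    unfolding space_L by auto
  also have "\<dots> \<in> sets L"
    by (intro sets.Int sets_prefix_L measurable_sets[OF measurable_coord_L]) simp
  finally show ?thesis .
qed

private lemma step_feasible: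
  assumes \<pi>: "\<pi> \<in> policies U" and es: "set es \<subseteq> feasible_pairs U"
  shows "measure_pmf.prob (step es) (- feasible_pairs U) = 0"
proof -
  have "measure_pmf.prob (\<pi> (length es) (es, x)) (U x) = 1" for x
    using \<pi> es by (auto simp: policies_def histories_def)
  then have "AE u in measure_pmf (\<pi> (length es) (es, x)). u \<in> U x" for x
    by (simp add: measure_pmf.prob_eq_1)
  then have "AE a in measure_pmf (step es). a \<in> feasible_pairs U"
    by (auto simp: step_def AE_measure_pmf_iff feasible_pairs_def)
  then show ?thesis
    by (subst measure_pmf.prob_eq_0) auto
qed

private lemma L_feasible:
  assumes \<pi>: "\<pi> \<in> policies U"
  shows "AE \<omega> in L. \<forall>t. \<omega> t \<in> feasible_pairs U"
proof -
  have z: "AE \<omega> in L. \<not> (map \<omega> [0..<n] = es \<and> \<omega> n \<in> - feasible_pairs U)"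
    if "set es \<subseteq> feasible_pairs U" for n es
  proof -
    have "measure L {\<omega>. map \<omega> [0..<n] = es \<and> \<omega> n \<in> - feasible_pairs U} = 0"
      unfolding L_Suc step_feasible[OF \<pi> that] by simp
    then have "{\<omega>. map \<omega> [0..<n] = es \<and> \<omega> n \<in> - feasible_pairs U} \<in> null_sets L"
      using sets_prefix_coord_L[of n es "- feasible_pairs U"] by (simp add: null_sets_def L.emeasure_eq_measure)
    from AE_not_in[OF this] show ?thesis by simp
  qed
  have "AE \<omega> in L. \<forall>n. \<forall>es. set es \<subseteq> feasible_pairs U \<longrightarrow> \<not> (map \<omega> [0..<n] = es \<and> \<omega> n \<in> - feasible_pairs U)"
    by (simp only: AE_all_countable) (use z in auto)
  then show ?thesis
  proof eventually_elim
    case (elim \<omega>)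
    have "\<omega> t \<in> feasible_pairs U" for t
    proof (induction t rule: less_induct)
      case (less t)
      then have "set (map \<omega> [0..<t]) \<subseteq> feasible_pairs U" by auto
      with elim show ?case by blast
    qed
    then show ?case by simp
  qed
qed

private lemma history_iff: "history_upto t \<omega> = (es, x) \<longleftrightarrow> map \<omega> [0..<t] = es \<and> \<omega> t \<in> {x} \<times> UNIV"
  by (auto simp: history_upto_def state_def prod_eq_iff mem_Times_iff)

private lemma history_action_iff:
  "history_upto t \<omega> = (es, x) \<and> action t \<omega> \<in> V \<longleftrightarrow> map \<omega> [0..<t] = es \<and> \<omega> t \<in> {x} \<times> V"
  by (auto simp: history_upto_def state_def action_def prod_eq_iff mem_Times_iff)

private lemma history_action_iff':
  "history_upto t \<omega> = (es, x) \<and> action t \<omega> = u \<longleftrightarrow> map \<omega> [0..<Suc t] = es @ [(x, u)]"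
  by (auto simp: history_upto_def state_def action_def prod_eq_iff)

private lemma strategic_exists:
  assumes \<pi>: "\<pi> \<in> policies U"
  shows "is_strategic_measure U Q \<nu> \<pi> L"
  unfolding is_strategic_measure_def
proof (intro conjI allI ballI impI)
  show "prob_space L" by (rule L.prob_space_axioms)
  show "sets L = sets trajectory_space" by (rule sets_L)
  show "\<P>(\<omega> in L. \<forall>t. \<omega> t \<in> feasible_pairs U) = 1"
  proof (subst L.prob_Collect_eq_1)
    have "{\<omega> \<in> space L. \<forall>t. \<omega> t \<in> feasible_pairs U} = (\<Inter>t. (\<lambda>\<omega>. \<omega> t) -` feasible_pairs U \<inter> space L)"
      by auto
    also have "\<dots> \<in> sets L"
      using measurable_sets[OF measurable_coord_L, of "feasible_pairs U"] by (intro sets.countable_INT) auto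
    finally show "{\<omega> \<in> space L. \<forall>t. \<omega> t \<in> feasible_pairs U} \<in> L.events" .
  qed (rule L_feasible[OF \<pi>])
next
  fix B
  have "{\<omega> \<in> space L. state 0 \<omega> \<in> B} = {\<omega>. map \<omega> [0..<0] = [] \<and> \<omega> 0 \<in> B \<times> UNIV}"
    unfolding space_L by (auto simp: state_def mem_Times_iff)
  moreover have u: "{\<omega>. map \<omega> [0..<0] = []} = space L" unfolding space_L by simp
  ultimately have "\<P>(\<omega> in L. state 0 \<omega> \<in> B) = measure L (space L) * measure_pmf.prob (step []) (B \<times> UNIV)"
    by (simp only: L_Suc u)
  then show "\<P>(\<omega> in L. state 0 \<omega> \<in> B) = measure_pmf.prob \<nu> B"
    by (simp only: L.prob_space prob_step_state next_state_def if_True mult_1 refl)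
next
  fix t h V assume h: "h \<in> histories U t" and pos: "0 < \<P>(\<omega> in L. history_upto t \<omega> = h)"
  obtain es x where hx: "h = (es, x)" by (cases h)
  have len: "length es = t" using h hx by (auto simp: histories_def)
  have 1: "\<P>(\<omega> in L. history_upto t \<omega> = h) = measure L {\<omega>. map \<omega> [0..<t] = es} * pmf (next_state es) x"
    unfolding hx history_iff space_L by (simp only: UNIV_I simp_thms L_Suc prob_step) simp
  have 2: "\<P>(\<omega> in L. action t \<omega> \<in> V \<and> history_upto t \<omega> = h) = measure L {\<omega>. map \<omega> [0..<t] = es} * (pmf (next_state es) x * measure_pmf.prob (\<pi> t h) V)"
    unfolding hx conj_commute[of "action _ _ \<in> _"] history_action_iff space_L
    by (simp only: UNIV_I simp_thms L_Suc prob_step len)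
  show "\<P>(\<omega> in L. action t \<omega> \<in> V \<bar> history_upto t \<omega> = h) = measure_pmf.prob (\<pi> t h) V"
    using pos unfolding cond_prob_def 2 unfolding 1 by auto
next
  fix t h u B assume h: "h \<in> histories U t" and pos: "0 < \<P>(\<omega> in L. history_upto t \<omega> = h \<and> action t \<omega> = u)"
  obtain es x where hx: "h = (es, x)" by (cases h)
  let ?es = "es @ [(x, u)]"
  have 1: "\<P>(\<omega> in L. history_upto t \<omega> = h \<and> action t \<omega> = u) = measure L {\<omega>. map \<omega> [0..<Suc t] = ?es}"
    unfolding hx history_action_iff' by (simp only: space_L UNIV_I simp_thms)
  have "{\<omega> \<in> space L. state (Suc t) \<omega> \<in> B \<and> history_upto t \<omega> = h \<and> action t \<omega> = u}
      = {\<omega>. map \<omega> [0..<Suc t] = ?es \<and> \<omega> (Suc t) \<in> B \<times> UNIV}"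
    unfolding hx history_action_iff' space_L by (auto simp: state_def mem_Times_iff)
  then have 2: "\<P>(\<omega> in L. state (Suc t) \<omega> \<in> B \<and> history_upto t \<omega> = h \<and> action t \<omega> = u)
      = measure L {\<omega>. map \<omega> [0..<Suc t] = ?es} * measure_pmf.prob (Q x u) B"
    by (simp only: L_Suc prob_step_state) (simp add: next_state_def)
  show "\<P>(\<omega> in L. state (Suc t) \<omega> \<in> B \<bar> history_upto t \<omega> = h \<and> action t \<omega> = u) = measure_pmf.prob (Q (snd h) u) B"
    using pos unfolding cond_prob_def 2 unfolding 1 by (simp add: hx)
qed

private lemma strategic_unique:
  assumes \<pi>: "\<pi> \<in> policies U" and P: "is_strategic_measure U Q \<nu> \<pi> P"
  shows "P = L"
proof -
  interpret P: prob_space P using P by (simp add: is_strategic_measure_def)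
  have sets_P: "sets P = sets L" and K: "\<P>(\<omega> in P. \<forall>t. \<omega> t \<in> feasible_pairs U) = 1"
    and init: "\<And>B. \<P>(\<omega> in P. state 0 \<omega> \<in> B) = measure_pmf.prob \<nu> B"
    using P unfolding is_strategic_measure_def sets_L by blast+
  have trans: "\<forall>t. \<forall>h\<in>histories U t. \<forall>u\<in>U (snd h). \<forall>B.
      \<P>(\<omega> in P. history_upto t \<omega> = h \<and> action t \<omega> = u) > 0 \<longrightarrow>
      \<P>(\<omega> in P. state (Suc t) \<omega> \<in> B \<bar> history_upto t \<omega> = h \<and> action t \<omega> = u)
        = measure_pmf.prob (Q (snd h) u) B"
    using P unfolding is_strategic_measure_def by (elim conjE)
  have space_P: "space P = UNIV" using sets_eq_imp_space_eq[OF sets_P] space_L by simp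
  have mP: "(\<lambda>\<omega>. \<omega> n) \<in> measurable P (count_space UNIV)" for n
    using measurable_coord_L[of n] by (simp only: measurable_cong_sets[OF sets_P refl])
  have setsK: "{\<omega> \<in> space P. \<forall>t. \<omega> t \<in> feasible_pairs U} \<in> P.events"
  proof -
    have "{\<omega> \<in> space P. \<forall>t. \<omega> t \<in> feasible_pairs U} = (\<Inter>t. (\<lambda>\<omega>. \<omega> t) -` feasible_pairs U \<inter> space P)"
      by auto
    also have "\<dots> \<in> P.events"
      using measurable_sets[OF mP, of "feasible_pairs U"] by (intro sets.countable_INT) auto
    finally show ?thesis .
  qed
  have AEK: "AE \<omega> in P. \<forall>t. \<omega> t \<in> feasible_pairs U"
    using K P.prob_Collect_eq_1[OF setsK] by simp
  have infeasible: "measure M {\<omega>. map \<omega> [0..<n] = es} = 0"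
    if "prob_space M" "sets M = sets L" "AE \<omega> in M. \<forall>t. \<omega> t \<in> feasible_pairs U" "\<not> set es \<subseteq> feasible_pairs U" for M n es
  proof -
    interpret M: prob_space M by fact
    have "{\<omega>. map \<omega> [0..<n] = es} \<in> sets M" using sets_prefix_L[of n "{es}"] that(2) by simp
    moreover have "AE \<omega> in M. \<omega> \<notin> {\<omega>. map \<omega> [0..<n] = es}"
      using that(3) by eventually_elim (use that(4) in auto)
    ultimately show ?thesis by (simp add: M.prob_eq_0)
  qed
  have act: "measure P {\<omega>. map \<omega> [0..<n] = es \<and> \<omega> n \<in> {x} \<times> V}
      = measure P {\<omega>. map \<omega> [0..<n] = es \<and> \<omega> n \<in> {x} \<times> UNIV} * measure_pmf.prob (\<pi> n (es, x)) V"
    if "length es = n" "set es \<subseteq> feasible_pairs U" for n es x V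
  proof (cases "measure P {\<omega>. map \<omega> [0..<n] = es \<and> \<omega> n \<in> {x} \<times> UNIV} = 0")
    case True
    have "measure P {\<omega>. map \<omega> [0..<n] = es \<and> \<omega> n \<in> {x} \<times> V} \<le> measure P {\<omega>. map \<omega> [0..<n] = es \<and> \<omega> n \<in> {x} \<times> UNIV}"
      using sets_prefix_coord_L[of n es] unfolding sets_P[symmetric] by (intro P.finite_measure_mono) auto
    with True show ?thesis by (simp add: measure_le_0_iff)
  next
    case False
    have h: "(es, x) \<in> histories U n" using that by (simp add: histories_def)
    have e: "\<P>(\<omega> in P. history_upto n \<omega> = (es, x)) = measure P {\<omega>. map \<omega> [0..<n] = es \<and> \<omega> n \<in> {x} \<times> UNIV}"
      unfolding history_iff by (simp only: space_P UNIV_I simp_thms)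
    have e': "\<P>(\<omega> in P. action n \<omega> \<in> V \<and> history_upto n \<omega> = (es, x)) = measure P {\<omega>. map \<omega> [0..<n] = es \<and> \<omega> n \<in> {x} \<times> V}"
      unfolding conj_commute[of "action _ _ \<in> _"] history_action_iff by (simp only: space_P UNIV_I simp_thms)
    have "0 < measure P {\<omega>. map \<omega> [0..<n] = es \<and> \<omega> n \<in> {x} \<times> UNIV}"
      using False by (simp only: zero_less_measure_iff not_False_eq_True)
    then have "\<P>(\<omega> in P. action n \<omega> \<in> V \<bar> history_upto n \<omega> = (es, x)) = measure_pmf.prob (\<pi> n (es, x)) V"
      using P h unfolding is_strategic_measure_def e[symmetric] by blast
    then show ?thesis unfolding cond_prob_def e e' using False by (simp add: field_simps)
  qed
  have st: "measure P {\<omega>. map \<omega> [0..<n] = es \<and> \<omega> n \<in> {x} \<times> UNIV}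
      = measure P {\<omega>. map \<omega> [0..<n] = es} * pmf (next_state es) x"
    if "length es = n" "set es \<subseteq> feasible_pairs U" for n es x
  proof (cases es rule: rev_cases)
    case Nil
    have "{\<omega>. map \<omega> [0..<n] = es \<and> \<omega> n \<in> {x} \<times> UNIV} = {\<omega> \<in> space P. state 0 \<omega> \<in> {x}}"
      using Nil that by (auto simp: space_P state_def mem_Times_iff)
    then show ?thesis
      using init[of "{x}"] Nil that P.prob_space by (simp add: next_state_def measure_pmf_single space_P)
  next
    case (snoc es' a)
    obtain y v where a: "a = (y, v)" by (cases a)
    define m where "m = length es'"
    have n: "n = Suc m" using that snoc m_def by simp
    have h: "(es', y) \<in> histories U m" "v \<in> U y"
      using that snoc a m_def by (auto simp: histories_def feasible_pairs_def)
    have e: "\<P>(\<omega> in P. history_upto m \<omega> = (es', y) \<and> action m \<omega> = v) = measure P {\<omega>. map \<omega> [0..<n] = es}"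
      unfolding history_action_iff' n snoc a by (simp only: space_P UNIV_I simp_thms)
    have "{\<omega> \<in> space P. state (Suc m) \<omega> \<in> {x} \<and> history_upto m \<omega> = (es', y) \<and> action m \<omega> = v}
        = {\<omega>. map \<omega> [0..<n] = es \<and> \<omega> n \<in> {x} \<times> UNIV}"
      unfolding history_action_iff' n snoc a by (auto simp: space_P state_def mem_Times_iff)
    then have e': "\<P>(\<omega> in P. state (Suc m) \<omega> \<in> {x} \<and> history_upto m \<omega> = (es', y) \<and> action m \<omega> = v)
        = measure P {\<omega>. map \<omega> [0..<n] = es \<and> \<omega> n \<in> {x} \<times> UNIV}" by simp
    show ?thesis
    proof (cases "measure P {\<omega>. map \<omega> [0..<n] = es} = 0")
      case True
      have "measure P {\<omega>. map \<omega> [0..<n] = es \<and> \<omega> n \<in> {x} \<times> UNIV} \<le> measure P {\<omega>. map \<omega> [0..<n] = es}"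
        using sets_prefix_L[of n "{es}"] unfolding sets_P[symmetric] by (intro P.finite_measure_mono) auto
      with True show ?thesis by (simp add: measure_le_0_iff)
    next
      case False
      then have "0 < measure P {\<omega>. map \<omega> [0..<n] = es}"
        by (simp only: zero_less_measure_iff not_False_eq_True)
      then have "\<P>(\<omega> in P. state (Suc m) \<omega> \<in> {x} \<bar> history_upto m \<omega> = (es', y) \<and> action m \<omega> = v)
          = measure_pmf.prob (Q (snd (es', y)) v) {x}"
        using trans[rule_format, of "(es', y)" m v "{x}"] h unfolding e[symmetric] by simp
      then show ?thesis unfolding cond_prob_def e e' using False snoc a
        by (simp add: field_simps next_state_def measure_pmf_single)
    qed
  qed
  have main: "measure P {\<omega>. map \<omega> [0..<n] = es} = measure L {\<omega>. map \<omega> [0..<n] = es}" for n es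
  proof (induction n arbitrary: es)
    case 0
    show ?case using P.prob_space L.prob_space unfolding space_P space_L by (cases "es = []") simp_all
  next
    case (Suc n)
    show ?case
    proof (cases "length es = Suc n")
      case False
      then have "{\<omega>. map \<omega> [0..<Suc n] = es} = {}" by auto
      then show ?thesis by (simp only: measure_empty)
    next
      case True
      then obtain es' x u where es: "es = es' @ [(x, u)]" "length es' = n"
        by (cases es rule: rev_cases) auto
      have s: "{\<omega>. map \<omega> [0..<Suc n] = es} = {\<omega>. map \<omega> [0..<n] = es' \<and> \<omega> n \<in> {x} \<times> {u}}"
        unfolding es(1) by auto
      show ?thesis
      proof (cases "set es' \<subseteq> feasible_pairs U")
        case True
        show ?thesis unfolding s L_Suc prob_step
          by (simp only: act[OF es(2) True, of x "{u}"] st[OF es(2) True] Suc.IH es(2) mult.assoc)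
      next
        case False
        then have "\<not> set es \<subseteq> feasible_pairs U" using es by auto
        then show ?thesis
          using infeasible[OF P.prob_space_axioms sets_P AEK] infeasible[OF L.prob_space_axioms refl L_feasible[OF \<pi>]]
          by (simp del: upt_Suc)
      qed
    qed
  qed
  show ?thesis
    by (rule trajectory_eqI)
       (simp_all add: sets_P sets_L[symmetric] P.finite_measure_axioms P.emeasure_eq_measure L.emeasure_eq_measure main)
qed

lemma ex1_strategic_measure: "\<pi> \<in> policies U \<Longrightarrow> \<exists>!P. is_strategic_measure U Q \<nu> \<pi> P"
  using strategic_exists strategic_unique by blast

lemma is_strategic_measure_strategic_measure:
  "\<pi> \<in> policies U \<Longrightarrow> is_strategic_measure U Q \<nu> \<pi> (strategic_measure U Q \<nu> \<pi>)"
  unfolding strategic_measure_def by (rule theI'[OF ex1_strategic_measure])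

end

end

theory Submission
  imports Defs
begin

text \<open>
  Every transition out of \<open>A\<close> along a feasible history has probability zero, and there are only
  countably many histories, so almost every trajectory stays in \<open>A\<close> once it has entered it. Hence
  the probability of \<open>X\<^sub>t \<in> A\<close> is that of \<open>\<tau>\<^sub>A \<le> t\<close>, which tends to the probability of
  \<open>\<tau>\<^sub>A < \<infinity>\<close>, and the Cesaro means have the same limit.
\<close>

text \<open>Averaging dilutes the finitely many terms far from \<open>l\<close>: their total
  deviation is a constant, while every later term deviates by less than
  \<open>e / 2\<close>.\<close>

lemma cesaro_mean:
  fixes f :: "nat \<Rightarrow> real"
  assumes "f \<longlonglongrightarrow> l"
  shows "(\<lambda>N. 1 / real N * (\<Sum>t<N. f t)) \<longlonglongrightarrow> l"
proof (rule LIMSEQ_I)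
  fix e :: real assume e: "0 < e"
  from LIMSEQ_D[OF assms, of "e / 2"] e obtain m where m: "\<And>n. n \<ge> m \<Longrightarrow> \<bar>f n - l\<bar> < e / 2"
    by auto
  define C where "C = (\<Sum>t<m. \<bar>f t - l\<bar>)"
  have bound: "(\<Sum>t<N. \<bar>f t - l\<bar>) \<le> C + real N * (e / 2)" for N
  proof (induction N)
    case 0
    show ?case by (simp add: C_def sum_nonneg)
  next
    case (Suc N)
    show ?case
    proof (cases "N < m")
      case True
      then have "(\<Sum>t<Suc N. \<bar>f t - l\<bar>) \<le> C"
        unfolding C_def by (intro sum_mono2) auto
      also have "C \<le> C + real (Suc N) * (e / 2)"
        using e by simp
      finally show ?thesis .
    next
      case False
      then show ?thesis using Suc.IH m[of N] by (simp add: algebra_simps add_divide_distrib)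
    qed
  qed
  \<comment> \<open>For \<open>n \<ge> k\<close> the early terms contribute
    \<open>C / n < e / 2\<close>; the \<open>max\<close> with 1 below also makes \<open>n\<close>
    positive, so that dividing by it is harmless.\<close>
  obtain k where k: "2 * C / e < real k"
    using reals_Archimedean2 by blast
  show "\<exists>n0. \<forall>n\<ge>n0. norm (1 / real n * (\<Sum>t<n. f t) - l) < e"
  proof (intro exI allI impI)
    fix n assume "n \<ge> max 1 k"
    then have n: "0 < real n" "2 * C / e < real n"
      using k by linarith+
    have "1 / real n * (\<Sum>t<n. f t) - l = (\<Sum>t<n. f t - l) / real n"
      using n by (simp add: sum_subtractf field_simps)
    then have "norm (1 / real n * (\<Sum>t<n. f t) - l) = \<bar>\<Sum>t<n. f t - l\<bar> / real n"
      using n by simp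
    also have "\<dots> \<le> (\<Sum>t<n. \<bar>f t - l\<bar>) / real n"
      by (intro divide_right_mono sum_abs) simp
    also have "\<dots> \<le> (C + real n * (e / 2)) / real n"
      by (intro divide_right_mono bound) simp
    also have "\<dots> < e"
      using n e by (simp add: field_simps)
    finally show "norm (1 / real n * (\<Sum>t<n. f t) - l) < e" .
  qed
qed

lemma hitting_time_less_infinity_iff: "hitting_time A \<omega> < \<infinity> \<longleftrightarrow> (\<exists>t. state t \<omega> \<in> A)"
  unfolding hitting_time_def Inf_less_iff by auto

text \<open>Finitely many conditions on coordinates replace an equation between lists, which makes
  the event visibly measurable.\<close>

lemma history_upto_eq_iff:
  "history_upto t \<omega> = (es, x) \<longleftrightarrow> length es = t \<and> (\<forall>i<t. \<omega> i = es ! i) \<and> state t \<omega> = x"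
  by (auto simp: history_upto_def list_eq_iff_nth_eq)

lemma history_upto_mem_histories:
  "(\<And>s. \<omega> s \<in> feasible_pairs U) \<Longrightarrow> history_upto t \<omega> \<in> histories U t"
  by (auto simp: history_upto_def histories_def)

text \<open>A sum of nonnegative terms that vanishes has only zero terms, and the factor
  \<open>pmf (\<pi> t h) u\<close> can be cancelled.\<close>

lemma closed_under_transition:
  assumes "closed_under U Q \<pi> A" and h: "h \<in> histories U t" and "snd h \<in> A"
    and u: "u \<in> U (snd h)" "pmf (\<pi> t h) u \<noteq> 0"
  shows "measure_pmf.prob (Q (snd h) u) (- A) = 0"
proof -
  let ?f = "\<lambda>u. measure_pmf.prob (Q (snd h) u) (- A) * pmf (\<pi> t h) u"
  have "length (fst h) = t"
    using h by (auto simp: histories_def)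
  \<comment> \<open>Closedness is applied with \<open>s = t\<close>: position \<open>t\<close> lies
    past the list of pairs, so it denotes the current state.\<close>
  then have "history_state h t \<in> A"
    using assms(3) by (simp add: history_state_def)
  then have "infsum ?f (U (snd h)) = 0"
    using assms(1) h unfolding closed_under_def by blast
  \<comment> \<open>Since \<open>infsum\<close> is 0 by default on families that are not summable,
    its value says nothing about the terms until summability is known. The action probabilities
    dominate.\<close>
  moreover have "?f summable_on U (snd h)"
  proof (rule summable_on_comparison_test)
    have "Infinite_Sum.abs_summable_on (pmf (\<pi> t h)) (U (snd h))"
      by (rule iffD2[OF abs_summable_equivalent pmf_abs_summable])
    then show "pmf (\<pi> t h) summable_on U (snd h)"
      by (rule abs_summable_summable)
  qed (auto intro: mult_left_le_one_le)
  ultimately have "?f u = 0"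
    using u(1) by (intro nonneg_infsum_le_0D[where f = ?f and A = "U (snd h)"]) auto
  with u(2) show ?thesis by simp
qed

lemma measurable_component_trajectory:
  assumes "sets P = sets trajectory_space"
  shows "(\<lambda>\<omega>. \<omega> n) \<in> measurable P (count_space UNIV)"
  unfolding measurable_cong_sets[OF assms refl] trajectory_space_def
  by (rule measurable_component_singleton) simp

lemma measurable_state:
  assumes "sets P = sets trajectory_space"
  shows "state n \<in> measurable P (count_space UNIV)"
  unfolding state_def[abs_def]
  by (rule measurable_compose[OF measurable_component_trajectory[OF assms]]) simp

lemma measurable_action:
  assumes "sets P = sets trajectory_space"
  shows "action n \<in> measurable P (count_space UNIV)"
  unfolding action_def[abs_def]
  by (rule measurable_compose[OF measurable_component_trajectory[OF assms]]) simp

text \<open>For each time, feasible history ending in \<open>A\<close> and feasible action, leaving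
  \<open>A\<close> next is a null event. There are countably many such triples, so the exceptional
  sets have a null union.\<close>

lemma AE_closed_under:
  fixes U :: "'x::countable \<Rightarrow> 'u::countable set"
  assumes P: "is_strategic_measure U Q \<nu> \<pi> P" and A: "closed_under U Q \<pi> A"
  shows "AE \<omega> in P. \<forall>t. state t \<omega> \<in> A \<longrightarrow> state (Suc t) \<omega> \<in> A"
proof -
  interpret prob_space P using P by (simp add: is_strategic_measure_def)
  have sets: "sets P = sets trajectory_space"
    and feasible: "\<P>(\<omega> in P. \<forall>t. \<omega> t \<in> feasible_pairs U) = 1"
    using P by (simp_all add: is_strategic_measure_def)
  have act: "\<P>(\<omega> in P. action t \<omega> \<in> V \<bar> history_upto t \<omega> = h) = measure_pmf.prob (\<pi> t h) V"
    if "h \<in> histories U t" "\<P>(\<omega> in P. history_upto t \<omega> = h) > 0" for t h V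
    using P that unfolding is_strategic_measure_def by blast
  have trans: "\<P>(\<omega> in P. state (Suc t) \<omega> \<in> B \<bar> history_upto t \<omega> = h \<and> action t \<omega> = u)
      = measure_pmf.prob (Q (snd h) u) B"
    if "h \<in> histories U t" "u \<in> U (snd h)"
      "\<P>(\<omega> in P. history_upto t \<omega> = h \<and> action t \<omega> = u) > 0" for t h u B
    using P that unfolding is_strategic_measure_def by blast
  note [measurable] = measurable_component_trajectory[OF sets] measurable_state[OF sets]
    measurable_action[OF sets]
  have hist [measurable]: "Measurable.pred P (\<lambda>\<omega>. history_upto t \<omega> = h)" for t h
    by (cases h) (simp add: history_upto_eq_iff)
  have AE_feasible: "AE \<omega> in P. \<forall>t. \<omega> t \<in> feasible_pairs U"
    using feasible by (subst (asm) prob_Collect_eq_1) simp_all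
  have null: "AE \<omega> in P. \<not> (history_upto t \<omega> = h \<and> action t \<omega> = u \<and> state (Suc t) \<omega> \<notin> A)"
    if h: "h \<in> histories U t" "snd h \<in> A" and u: "u \<in> U (snd h)" for t h u
  proof -
    let ?E = "{\<omega> \<in> space P. history_upto t \<omega> = h \<and> action t \<omega> = u}"
    let ?F = "{\<omega> \<in> space P. state (Suc t) \<omega> \<in> - A \<and> history_upto t \<omega> = h \<and> action t \<omega> = u}"
    have "prob ?F = 0"
    \<comment> \<open>The transition law is prescribed only given events of positive probability; if
      \<open>?E\<close> is null, so is its subset \<open>?F\<close>.\<close>
    proof (cases "prob ?E = 0")
      case True
      have "prob ?F \<le> prob ?E"
        by (intro finite_measure_mono) auto
      with True show ?thesis
        by (simp add: measure_le_0_iff)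
    next
      case False
      then have E: "prob ?E > 0"
        by (simp add: zero_less_measure_iff)
      also have "prob ?E \<le> \<P>(\<omega> in P. history_upto t \<omega> = h)"
        by (intro finite_measure_mono) auto
      finally have "\<P>(\<omega> in P. history_upto t \<omega> = h) > 0" .
      then have "\<P>(\<omega> in P. history_upto t \<omega> = h) \<noteq> 0"
        and "\<P>(\<omega> in P. action t \<omega> \<in> {u} \<bar> history_upto t \<omega> = h) = pmf (\<pi> t h) u"
        using act[OF h(1), of "{u}"] by (simp_all add: measure_pmf_single)
      \<comment> \<open>The probability of \<open>?E\<close> is that of the history times
        \<open>pmf (\<pi> t h) u\<close>, and it is positive.\<close>
      with False have "pmf (\<pi> t h) u \<noteq> 0"
        by (auto simp: cond_prob_def conj_commute)
      then have "measure_pmf.prob (Q (snd h) u) (- A) = 0"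
        using closed_under_transition[OF A h u] by simp
      with trans[OF h(1) u E, of "- A"] False show ?thesis
        by (simp add: cond_prob_def)
    qed
    moreover have "?F \<in> events" by measurable
    ultimately have "AE \<omega> in P. \<omega> \<notin> ?F"
      by (simp only: prob_eq_0)
    then show ?thesis
      using AE_space by eventually_elim auto
  qed
  have "AE \<omega> in P. \<forall>t h u. h \<in> histories U t \<longrightarrow> snd h \<in> A \<longrightarrow> u \<in> U (snd h) \<longrightarrow>
      \<not> (history_upto t \<omega> = h \<and> action t \<omega> = u \<and> state (Suc t) \<omega> \<notin> A)"
    unfolding AE_all_countable using null by auto
  with AE_feasible show ?thesis
  proof eventually_elim
    case (elim \<omega>)
    \<comment> \<open>The trajectory's own history and action at time \<open>t\<close> are feasible,
      so they form one of the triples excluded above.\<close>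
    show ?case
    proof (intro allI impI)
      fix t assume "state t \<omega> \<in> A"
      moreover have "history_upto t \<omega> \<in> histories U t"
        using elim(1) by (simp add: history_upto_mem_histories)
      moreover have "action t \<omega> \<in> U (snd (history_upto t \<omega>))"
        using spec[OF elim(1), of t]
        by (auto simp: history_upto_def action_def state_def feasible_pairs_def)
      moreover have "snd (history_upto t \<omega>) = state t \<omega>"
        by (simp add: history_upto_def)
      ultimately show "state (Suc t) \<omega> \<in> A"
        using elim(2) by metis
    qed
  qed
qed

theorem theorem9:
  fixes U :: "'x::countable \<Rightarrow> 'u::countable set"
    and Q :: "'x \<Rightarrow> 'u \<Rightarrow> 'x pmf"
    and \<pi> :: "('x, 'u) policy"
    and A :: "'x set"
    and x :: 'x
  assumes "\<pi> \<in> policies U"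
    and "closed_under U Q \<pi> A"
  defines "P \<equiv> strategic_measure U Q (return_pmf x) \<pi>"
  shows "limsup (\<lambda>N. ereal (1 / real N * (\<integral>\<omega>. (\<Sum>t<N. indicator A (state t \<omega>)) \<partial>P)))
    = ereal (\<P>(\<omega> in P. hitting_time A \<omega> < \<infinity>))"
proof -
  have strategic: "is_strategic_measure U Q (return_pmf x) \<pi> P"
    unfolding P_def by (rule is_strategic_measure_strategic_measure) fact
  interpret prob_space P
    using strategic by (simp add: is_strategic_measure_def)
  have sets: "sets P = sets trajectory_space"
    using strategic by (simp add: is_strategic_measure_def)
  note [measurable] = measurable_state[OF sets]
  \<comment> \<open>This is the event \<open>hitting_time A \<omega> \<le> t\<close>; unlike
    \<open>state t \<omega> \<in> A\<close>, it increases with \<open>t\<close> on every trajectory,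
    so continuity from below applies.\<close>
  let ?B = "\<lambda>t. {\<omega> \<in> space P. \<exists>s\<le>t. state s \<omega> \<in> A}"
  have state_prob: "\<P>(\<omega> in P. state t \<omega> \<in> A) = prob (?B t)" for t
  proof (rule prob_eq_AE)
    show "AE \<omega> in P. state t \<omega> \<in> A \<longleftrightarrow> (\<exists>s\<le>t. state s \<omega> \<in> A)"
      using AE_closed_under[OF strategic assms(2)]
    proof eventually_elim
      case (elim \<omega>)
      have "state t \<omega> \<in> A" if "s \<le> t" "state s \<omega> \<in> A" for s
        using that by (induction rule: dec_induct) (use elim in auto)
      then show ?case by blast
    qed
  qed measurable
  have "(\<Union>t. ?B t) = {\<omega> \<in> space P. hitting_time A \<omega> < \<infinity>}"
    unfolding hitting_time_less_infinity_iff by blast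
  moreover have "(\<lambda>t. prob (?B t)) \<longlonglongrightarrow> prob (\<Union>t. ?B t)"
  proof (rule finite_Lim_measure_incseq)
    show "range ?B \<subseteq> events" by auto
    show "incseq ?B" by (intro incseq_SucI) (auto intro: le_SucI)
  qed
  ultimately have lim: "(\<lambda>t. \<P>(\<omega> in P. state t \<omega> \<in> A)) \<longlonglongrightarrow> \<P>(\<omega> in P. hitting_time A \<omega> < \<infinity>)"
    by (simp only: state_prob)
  \<comment> \<open>As the indicator of an event, the integrand has that event's probability as its
    integral.\<close>
  have ind: "(\<lambda>\<omega>. indicator A (state t \<omega>) :: real) = indicator {\<omega>. state t \<omega> \<in> A}" for t
    by (auto simp: indicator_def)
  have "(\<integral>\<omega>. indicator A (state t \<omega>) \<partial>P) = \<P>(\<omega> in P. state t \<omega> \<in> A)" for t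
    unfolding ind by (simp add: Int_def conj_commute)
  moreover have "integrable P (\<lambda>\<omega>. indicator A (state t \<omega>) :: real)" for t
    by (rule integrable_const_bound[where B = 1]) (auto simp: indicator_def)
  ultimately have "(\<integral>\<omega>. (\<Sum>t<N. indicator A (state t \<omega>)) \<partial>P)
      = (\<Sum>t<N. \<P>(\<omega> in P. state t \<omega> \<in> A))" for N
    by simp
  \<comment> \<open>The means converge, so their limsup is the limit.\<close>
  with cesaro_mean[OF lim] show ?thesis
    by (intro lim_imp_Limsup) simp_all
qed

end
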